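(* Let $\sigma\ge1$, let $\varphi=(\varphi_1,\dots,\varphi_b)$ be a solid $b$-fold $L^*(2,1)$-labeling of $G_{[1,\sigma]}$ with $k$ labels, let $\eta$ be a shading of $\varphi$, and let $(D_i)_{i\in[n]}$ be a sequence of disks with diameters in $[1,\sigma]$. Then algorithm FoldShadeColor with $\varphi,\eta$ on input $(D_i)_{i\in[n]}$ returns an $L(2,1)$-labeling of $G=G((D_i)_{i\in[n]})$ whose largest label does not exceed $k\cdot\left\lfloor\frac{\omega(G)+(b-1)\gamma/2}{b}\right\rfloor$, where $\gamma$ is the maximum number of subtiles in one tile of $\varphi$.
   Context: $G_{[1,\sigma]}$ is the infinite graph on $\mathbb R^2$ with two points adjacent iff their distance lies in $[1,\sigma]$. A solid $b$-fold $k$-coloring of $G_{[1,\sigma]}$ is a tuple $(\varphi_1,\dots,\varphi_b)$ of maps $\mathbb R^2\to$ labels with $\varphi_r(p)\ne\varphi_s(p)$ for $r\ne s$ and $\varphi_r(p_1)\ne\varphi_s(p_2)$ whenever $\mathrm{dist}(p_1,p_2)\in[1,\sigma]$, together with $b$ tilings of the plane into congruent tiles (layers) such that $\varphi_r$ is constant on each tile of layer $r$, any two points of one tile are at distance less than $1$, and distinct tiles of the same color (possibly from different layers) are at distance greater than $\sigma$. It is a solid $b$-fold $L^*(2,1)$-labeling with $k$ labels if: (1) all labels lie in $\{1,\dots,k\}$ or all in $\{0,\dots,k-1\}$; (2) tiles with the same label are at point-to-point distance greater than $2\sigma$; (3) tiles with consecutive labels are at distance greater than $\sigma$; (4) a tile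 with the smallest label and a tile with the largest label are at distance greater than $\sigma$. A subtile is a non-empty intersection of $b$ tiles, one from each layer; a shading is a function $\eta$ from subtiles to $[b]$ such that in every tile each value is taken by the same number of subtiles. For disks $(D_i)$, $G((D_i))$ has one vertex $v_i$ per disk, identified with its center (distinct disks give distinct vertices), with $v_iv_j$ an edge iff the disks intersect; $\omega(G)$ is its clique number. An $L(2,1)$-labeling of a graph is an integer labeling $c$ with $|c(v)-c(w)|\ge2$ for adjacent $v,w$ and $c(v)\ne c(w)$ for $v,w$ at graph distance $2$. Algorithm FoldShadeColor (online): when $D_i$ is read, let $T_r(v_i)$ be the tile of layer $r$ containing $v_i$, $S=\bigcap_rT_r(v_i)$, $m$ the number of earlier vertices in $S$; set $\ell(v_i)=1+((\eta(S)-1+m)\bmod b)$; let $t(v_i)$ be the number of earlier vertices $u$ in $T_{\ell(v_i)}(v_i)$ with $\ell(u)=\ell(v_i)$; assign $c(v_i)=\varphi_{\ell(v_i)}(v_i)+k\,t(v_i)$. *)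

theory Defs
  imports "HOL-Analysis.Analysis" "HOL-Library.Ramsey" "HOL-Library.Extended_Nat"
begin

type_synonym plane = "real ^ 2"

section \<open>Tilings and solid colorings of the plane\<close>

definition congruent_sets :: "plane set \<Rightarrow> plane set \<Rightarrow> bool" where
  "congruent_sets A B \<longleftrightarrow> (\<exists>f. (\<forall>x y. dist (f x) (f y) = dist x y) \<and> f ` A = B)"

text \<open>Every point has to lie in exactly one tile, so boundary points are allotted to one of
  the adjacent tiles, and a tiling is a partition of the plane.\<close>

definition tiling :: "plane set set \<Rightarrow> bool" where
  "tiling \<T> \<longleftrightarrow> partition_on UNIV \<T> \<and> (\<forall>T\<in>\<T>. \<forall>U\<in>\<T>. congruent_sets T U)"

text \<open>The distance between two tiles is read pointwise; the infimum over all pairs of points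
  may be equal to \<open>d\<close>.\<close>

definition farther_than :: "real \<Rightarrow> plane set \<Rightarrow> plane set \<Rightarrow> bool" where
  "farther_than d T U \<longleftrightarrow> (\<forall>p\<in>T. \<forall>q\<in>U. d < dist p q)"

definition range_graph_adj :: "real \<Rightarrow> plane \<Rightarrow> plane \<Rightarrow> bool" where
  "range_graph_adj \<sigma> p q \<longleftrightarrow> dist p q \<in> {1..\<sigma>}"

definition fold_coloring :: "nat \<Rightarrow> nat \<Rightarrow> real \<Rightarrow> (nat \<Rightarrow> plane \<Rightarrow> 'c) \<Rightarrow> bool" where
  "fold_coloring b k \<sigma> \<phi> \<longleftrightarrow>
     b \<ge> 1 \<and>
     (\<exists>C. finite C \<and> card C = k \<and> (\<forall>r\<in>{1..b}. range (\<phi> r) \<subseteq> C)) \<and>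
     (\<forall>r\<in>{1..b}. \<forall>s\<in>{1..b}. \<forall>p. r \<noteq> s \<longrightarrow> \<phi> r p \<noteq> \<phi> s p) \<and>
     (\<forall>r\<in>{1..b}. \<forall>s\<in>{1..b}. \<forall>p q. range_graph_adj \<sigma> p q \<longrightarrow> \<phi> r p \<noteq> \<phi> s q)"

text \<open>For a map that is constant on the nonempty tile \<open>T\<close>, this is its value there.\<close>

definition tile_label :: "(plane \<Rightarrow> 'c) \<Rightarrow> plane set \<Rightarrow> 'c" where
  "tile_label f T = the_elem (f ` T)"

text \<open>\<open>L r\<close> is the tiling of layer \<open>r\<close>; the layers and the components of \<open>\<phi>\<close> are indexed
  by \<open>1, \<dots>, b\<close>.\<close>

definition solid_fold_coloring ::
  "nat \<Rightarrow> nat \<Rightarrow> real \<Rightarrow> (nat \<Rightarrow> plane \<Rightarrow> 'c) \<Rightarrow> (nat \<Rightarrow> plane set set) \<Rightarrow> bool" where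
  "solid_fold_coloring b k \<sigma> \<phi> L \<longleftrightarrow>
     fold_coloring b k \<sigma> \<phi> \<and>
     (\<forall>r\<in>{1..b}. tiling (L r)) \<and>
     (\<forall>r\<in>{1..b}. \<forall>T\<in>L r. \<phi> r constant_on T) \<and>
     (\<forall>r\<in>{1..b}. \<forall>T\<in>L r. \<forall>p\<in>T. \<forall>q\<in>T. dist p q < 1) \<and>
     (\<forall>r\<in>{1..b}. \<forall>s\<in>{1..b}. \<forall>T\<in>L r. \<forall>U\<in>L s.
        (r, T) \<noteq> (s, U) \<and> tile_label (\<phi> r) T = tile_label (\<phi> s) U \<longrightarrow> farther_than \<sigma> T U)"

text \<open>The label set is \<open>{a, \<dots>, a + k - 1}\<close> with \<open>a \<in> {0, 1}\<close>; the smallest and the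
  largest label are those of this set.\<close>

definition solid_Lstar21_labeling ::
  "nat \<Rightarrow> nat \<Rightarrow> real \<Rightarrow> (nat \<Rightarrow> plane \<Rightarrow> int) \<Rightarrow> (nat \<Rightarrow> plane set set) \<Rightarrow> bool" where
  "solid_Lstar21_labeling b k \<sigma> \<phi> L \<longleftrightarrow>
     solid_fold_coloring b k \<sigma> \<phi> L \<and>
     (\<exists>a\<in>{0, 1}.
        (\<forall>r\<in>{1..b}. range (\<phi> r) \<subseteq> {a..a + int k - 1}) \<and>
        (\<forall>r\<in>{1..b}. \<forall>s\<in>{1..b}. \<forall>T\<in>L r. \<forall>U\<in>L s.
           ((r, T) \<noteq> (s, U) \<and> tile_label (\<phi> r) T = tile_label (\<phi> s) U
              \<longrightarrow> farther_than (2 * \<sigma>) T U) \<and>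
           (tile_label (\<phi> s) U = tile_label (\<phi> r) T + 1 \<longrightarrow> farther_than \<sigma> T U) \<and>
           (tile_label (\<phi> r) T = a \<and> tile_label (\<phi> s) U = a + int k - 1
              \<longrightarrow> farther_than \<sigma> T U)))"

section \<open>Subtiles and shadings\<close>

definition subtiles :: "nat \<Rightarrow> (nat \<Rightarrow> plane set set) \<Rightarrow> plane set set" where
  "subtiles b L = {\<Inter>r\<in>{1..b}. T r | T. \<forall>r\<in>{1..b}. T r \<in> L r} - {{}}"

definition subtiles_in :: "nat \<Rightarrow> (nat \<Rightarrow> plane set set) \<Rightarrow> plane set \<Rightarrow> plane set set" where
  "subtiles_in b L T = {S \<in> subtiles b L. S \<subseteq> T}"

text \<open>In a solid labeling with \<open>k\<close> labels, at most \<open>k\<close> tiles of each layer meet a given tile,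
  since such tiles have pairwise different labels. Hence a tile has finitely many subtiles,
  and their number is bounded over all tiles; the cardinalities below and \<open>Max\<close> are proper.\<close>

definition shading :: "nat \<Rightarrow> (nat \<Rightarrow> plane set set) \<Rightarrow> (plane set \<Rightarrow> nat) \<Rightarrow> bool" where
  "shading b L \<eta> \<longleftrightarrow>
     \<eta> ` subtiles b L \<subseteq> {1..b} \<and>
     (\<forall>r\<in>{1..b}. \<forall>T\<in>L r. \<forall>x\<in>{1..b}. \<forall>y\<in>{1..b}.
        card {S \<in> subtiles_in b L T. \<eta> S = x} = card {S \<in> subtiles_in b L T. \<eta> S = y})"

definition max_subtiles :: "nat \<Rightarrow> (nat \<Rightarrow> plane set set) \<Rightarrow> nat" where
  "max_subtiles b L = Max {card (subtiles_in b L T) | r T. r \<in> {1..b} \<and> T \<in> L r}"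

section \<open>Graphs\<close>

text \<open>A graph is given by its vertex set \<open>V\<close> and its set \<open>E\<close> of two-element edges.\<close>

definition clique_number :: "'v set \<Rightarrow> 'v set set \<Rightarrow> nat" where
  "clique_number V E = Max {card K | K. K \<subseteq> V \<and> clique K E}"

text \<open>The length of a shortest walk, \<open>\<infinity>\<close> if there is none.\<close>

definition graph_dist :: "'v set set \<Rightarrow> 'v \<Rightarrow> 'v \<Rightarrow> enat" where
  "graph_dist E u v = (INF m\<in>{m. (u, v) \<in> {(x, y). {x, y} \<in> E} ^^ m}. enat m)"

definition L21_labeling :: "'v set \<Rightarrow> 'v set set \<Rightarrow> ('v \<Rightarrow> int) \<Rightarrow> bool" where
  "L21_labeling V E c \<longleftrightarrow>
     (\<forall>v\<in>V. \<forall>w\<in>V.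
        ({v, w} \<in> E \<longrightarrow> \<bar>c v - c w\<bar> \<ge> 2) \<and>
        (graph_dist E v w = 2 \<longrightarrow> c v \<noteq> c w))"

section \<open>Disk graphs\<close>

text \<open>A disk is a pair of its center and its diameter.\<close>

type_synonym disk = "plane \<times> real"

definition center :: "disk \<Rightarrow> plane" where
  "center D = fst D"

definition diam :: "disk \<Rightarrow> real" where
  "diam D = snd D"

definition disk_region :: "disk \<Rightarrow> plane set" where
  "disk_region D = cball (center D) (diam D / 2)"

text \<open>The vertex of the \<open>i\<close>-th disk is the index \<open>i \<in> {1..n}\<close>, located at \<open>center (D i)\<close>;
  disks with a common center yield different vertices.\<close>

definition disk_graph_edges :: "nat \<Rightarrow> (nat \<Rightarrow> disk) \<Rightarrow> nat set set" where
  "disk_graph_edges n D =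
     {{i, j} | i j. i \<in> {1..n} \<and> j \<in> {1..n} \<and> i \<noteq> j \<and>
        disk_region (D i) \<inter> disk_region (D j) \<noteq> {}}"

section \<open>Algorithm FoldShadeColor\<close>

definition tile_at :: "plane set set \<Rightarrow> plane \<Rightarrow> plane set" where
  "tile_at \<T> p = (THE T. T \<in> \<T> \<and> p \<in> T)"

definition subtile_at :: "nat \<Rightarrow> (nat \<Rightarrow> plane set set) \<Rightarrow> plane \<Rightarrow> plane set" where
  "subtile_at b L p = (\<Inter>r\<in>{1..b}. tile_at (L r) p)"

text \<open>The values at step \<open>i\<close> depend only on the disks \<open>D 1, \<dots>, D i\<close>.\<close>

definition fsc_layer ::
  "nat \<Rightarrow> (nat \<Rightarrow> plane set set) \<Rightarrow> (plane set \<Rightarrow> nat) \<Rightarrow> (nat \<Rightarrow> disk) \<Rightarrow> nat \<Rightarrow> nat" where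
  "fsc_layer b L \<eta> D i =
     (let S = subtile_at b L (center (D i));
          m = card {j \<in> {1..<i}. center (D j) \<in> S}
      in 1 + (\<eta> S - 1 + m) mod b)"

definition fsc_rank ::
  "nat \<Rightarrow> (nat \<Rightarrow> plane set set) \<Rightarrow> (plane set \<Rightarrow> nat) \<Rightarrow> (nat \<Rightarrow> disk) \<Rightarrow> nat \<Rightarrow> nat" where
  "fsc_rank b L \<eta> D i =
     (let l = fsc_layer b L \<eta> D i
      in card {j \<in> {1..<i}. center (D j) \<in> tile_at (L l) (center (D i)) \<and>
                            fsc_layer b L \<eta> D j = l})"

definition FoldShadeColor ::
  "nat \<Rightarrow> nat \<Rightarrow> (nat \<Rightarrow> plane \<Rightarrow> int) \<Rightarrow> (nat \<Rightarrow> plane set set) \<Rightarrow> (plane set \<Rightarrow> nat) \<Rightarrow>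
   (nat \<Rightarrow> disk) \<Rightarrow> nat \<Rightarrow> int" where
  "FoldShadeColor b k \<phi> L \<eta> D i =
     \<phi> (fsc_layer b L \<eta> D i) (center (D i)) + int k * int (fsc_rank b L \<eta> D i)"

end

theory Submission
  imports Defs
begin

text \<open>
  The label \<open>c i\<close> lies in the residue class of \<open>\<phi>\<close> modulo \<open>k\<close>, and the \<open>L\<^sup>*(2,1)\<close> conditions
  say that the labels of tiles at distance at most \<open>\<sigma>\<close> differ by at least \<open>2\<close> cyclically
  modulo \<open>k\<close>; vertices in the same tile and layer are separated by their ranks.

  For the bound, fix a tile \<open>T\<close> of layer \<open>l\<close> containing \<open>N\<close> centers. These form a clique,
  so \<open>N \<le> \<omega>\<close>. In a subtile \<open>S\<close> of \<open>T\<close> with \<open>m\<close> centers the layers are assigned in cyclic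
  order starting at \<open>\<eta> S\<close>, so that exactly \<open>\<lfloor>(m + f) / b\<rfloor>\<close> of them go to layer \<open>l\<close>, where
  \<open>f = (\<eta> S - 1 - l) mod b\<close>. As the shading is balanced, \<open>f\<close> averages to \<open>(b - 1) / 2\<close> over
  the at most \<open>\<gamma>\<close> subtiles of \<open>T\<close>, so layer \<open>l\<close> gets at most \<open>(N + (b - 1) \<gamma> / 2) / b\<close>
  centers of \<open>T\<close>.
\<close>

section \<open>Counting in residue classes\<close>

text \<open>The first hit is \<open>m0 = (x - e) mod b\<close>, read in the integers, and the offset
  added to \<open>M\<close> equals \<open>b - 1 - m0\<close>. So the quotient jumps exactly when
  \<open>M\<close> passes a number congruent to \<open>m0\<close>.\<close>

lemma card_residue_class_lessThan:
  fixes b e x M :: nat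
  assumes "x < b"
  shows "card {m \<in> {..<M}. (e + m) mod b = x} = (M + (e + (b - 1 - x)) mod b) div b"
proof (induction M)
  case 0
  have "(e + (b - 1 - x)) mod b < b" using assms by simp
  then show ?case by simp
next
  case (Suc M)
  define f where "f = (e + (b - 1 - x)) mod b"
  have "{m \<in> {..<Suc M}. (e + m) mod b = x} =
      (if (e + M) mod b = x then insert M {m \<in> {..<M}. (e + m) mod b = x}
       else {m \<in> {..<M}. (e + m) mod b = x})"
    by (auto simp: less_Suc_eq)
  then have card_Suc: "card {m \<in> {..<Suc M}. (e + m) mod b = x} =
      card {m \<in> {..<M}. (e + m) mod b = x} + (if (e + M) mod b = x then 1 else 0)"
    by simp
  \<comment> \<open>The quotient grows by one at \<open>Suc M\<close> iff \<open>b\<close> divides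
    \<open>Suc (M + f)\<close>; this has to coincide with \<open>M\<close> being a hit.\<close>
  have "Suc (M + f) mod b = (e + M + (b - x)) mod b"
  proof -
    have "Suc (M + f) mod b = (Suc M + (e + (b - 1 - x))) mod b"
      unfolding f_def by (metis add_Suc mod_add_right_eq)
    also have "Suc M + (e + (b - 1 - x)) = e + M + (b - x)" using assms by simp
    finally show ?thesis .
  qed
  also have "\<dots> = 0 \<longleftrightarrow> (e + M) mod b = x"
  proof
    assume "(e + M + (b - x)) mod b = 0"
    then have "((e + M) mod b + (b - x)) mod b = 0" by (simp add: mod_add_left_eq)
    then obtain q where q: "(e + M) mod b + (b - x) = b * q" by (metis mod_0_imp_dvd dvdE)
    \<comment> \<open>The sum lies strictly between \<open>0\<close> and \<open>2 * b\<close>, so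
      the only multiple of \<open>b\<close> it can be is \<open>b\<close>.\<close>
    have lt: "(e + M) mod b < b" using assms by simp
    then have "b * q < b * 2" using q assms by linarith
    then have "q < 2" by simp
    moreover have "q \<noteq> 0" using q assms by (metis add_is_0 mult_0_right zero_less_diff less_numeral_extra(3))
    ultimately have "q = 1" by simp
    then show "(e + M) mod b = x" using q assms by simp
  next
    assume "(e + M) mod b = x"
    then show "(e + M + (b - x)) mod b = 0"
      using assms by (metis le_add_diff_inverse less_imp_le_nat mod_add_left_eq mod_self)
  qed
  finally show ?case
    using Suc card_Suc unfolding f_def [symmetric] by (simp add: div_Suc mod_eq_0_iff_dvd)
qed

text \<open>Counting predecessors is strictly increasing on \<open>J\<close>, hence injective into a
  set of the same size. It replaces the vertices of a subtile by their positions in order of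
  arrival.\<close>

lemma bij_betw_card_below:
  fixes J :: "nat set"
  assumes "finite J"
  shows "bij_betw (\<lambda>j. card {i \<in> J. i < j}) J {..<card J}"
proof -
  have mono: "card {i \<in> J. i < j} < card {i \<in> J. i < j'}" if "j \<in> J" "j < j'" for j j'
    using assms that by (intro psubset_card_mono) auto
  have inj: "inj_on (\<lambda>j. card {i \<in> J. i < j}) J"
    by (rule linorder_inj_onI') (use mono in \<open>auto dest: less_imp_neq\<close>)
  have "card {i \<in> J. i < j} < card J" if "j \<in> J" for j
    using assms that by (intro psubset_card_mono) auto
  then have "(\<lambda>j. card {i \<in> J. i < j}) ` J \<subseteq> {..<card J}" by auto
  then have "(\<lambda>j. card {i \<in> J. i < j}) ` J = {..<card J}"
    using inj by (intro card_subset_eq) (auto simp: card_image)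
  with inj show ?thesis by (simp add: bij_betw_def)
qed

text \<open>Enumerating \<open>J\<close> in increasing order reduces this to the residue count;
  multiplying by \<open>b\<close> removes the rounding.\<close>

lemma card_cyclic_assignment_le:
  fixes J :: "nat set" and b e x :: nat
  assumes "finite J" "x < b"
  shows "b * card {j \<in> J. (e + card {i \<in> J. i < j}) mod b = x}
    \<le> card J + (e + (b - 1 - x)) mod b"
proof -
  have "bij_betw (\<lambda>j. card {i \<in> J. i < j}) {j \<in> J. (e + card {i \<in> J. i < j}) mod b = x}
      {m \<in> {..<card J}. (e + m) mod b = x}"
    using bij_betw_card_below[OF assms(1)] by (auto simp: bij_betw_def inj_on_def)
  then have "card {j \<in> J. (e + card {i \<in> J. i < j}) mod b = x} =
      (card J + (e + (b - 1 - x)) mod b) div b"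
    using card_residue_class_lessThan[OF assms(2)] by (simp add: bij_betw_same_card)
  then show ?thesis by simp
qed

lemma sum_mod_shift_lessThan:
  fixes b y :: nat
  assumes "b > 0"
  shows "(\<Sum>e<b. (e + y) mod b) = (\<Sum>e<b. e)"
proof (rule sum.reindex_bij_betw)
  have inj: "inj_on (\<lambda>e. (e + y) mod b) {..<b}"
  proof (rule inj_onI)
    fix e e' assume *: "e \<in> {..<b}" "e' \<in> {..<b}" "(e + y) mod b = (e' + y) mod b"
    \<comment> \<open>The shift is undone by adding \<open>- y\<close>, which is why the congruence
      moves to the integers.\<close>
    then have "e mod b = e' mod b" 
      using mod_add_cong[of "int e + int y" "int b" "int e' + int y" "- int y" "- int y"]
      by (simp flip: of_nat_add of_nat_mod)
    with * show "e = e'" by simp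
  qed
  moreover have "(\<lambda>e. (e + y) mod b) ` {..<b} = {..<b}"
    using inj assms by (intro card_subset_eq) (auto simp: card_image)
  ultimately show "bij_betw (\<lambda>e. (e + y) mod b) {..<b} {..<b}" by (simp add: bij_betw_def)
qed

text \<open>All \<open>b\<close> values of \<eta> are taken equally often, so the sum consists of
  complete residue systems modulo \<open>b\<close>, which a shift by \<open>y\<close> only permutes.
  Doubling avoids the fraction \<open>(b - 1) / 2\<close>.\<close>

lemma sum_balanced_mod:
  fixes b y :: nat and \<eta> :: "'s \<Rightarrow> nat"
  assumes fin: "finite A" and "b > 0" and ran: "\<eta> ` A \<subseteq> {1..b}"
    and bal: "\<And>v w. v \<in> {1..b} \<Longrightarrow> w \<in> {1..b} \<Longrightarrow>
      card {S \<in> A. \<eta> S = v} = card {S \<in> A. \<eta> S = w}"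
  shows "2 * (\<Sum>S\<in>A. (\<eta> S - 1 + y) mod b) = card A * (b - 1)"
proof -
  define g where "g = card {S \<in> A. \<eta> S = 1}"
  have g: "card {S \<in> A. \<eta> S = v} = g" if "v \<in> {1..b}" for v
    unfolding g_def using that \<open>b > 0\<close> by (intro bal) auto
  have "card A = (\<Sum>v\<in>{1..b}. card {S \<in> A. \<eta> S = v})"
    using sum.group[OF fin finite_atLeastAtMost ran, of "\<lambda>_. 1::nat"] by simp
  also have "\<dots> = b * g" using g by simp
  finally have card_A: "card A = b * g" .
  have "(\<Sum>S\<in>A. (\<eta> S - 1 + y) mod b) =
      (\<Sum>v\<in>{1..b}. \<Sum>S\<in>{S \<in> A. \<eta> S = v}. (\<eta> S - 1 + y) mod b)"
    using sum.group[OF fin finite_atLeastAtMost ran, of "\<lambda>S. (\<eta> S - 1 + y) mod b"] by simp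
  also have "\<dots> = (\<Sum>v\<in>{1..b}. g * ((v - 1 + y) mod b))"
    using g by (intro sum.cong) auto
  also have "\<dots> = g * (\<Sum>v\<in>{1..b}. (v - 1 + y) mod b)" by (simp add: sum_distrib_left)
  also have "(\<Sum>v\<in>{1..b}. (v - 1 + y) mod b) = (\<Sum>e<b. (e + y) mod b)"
    by (rule sum.reindex_bij_witness[of _ Suc "\<lambda>v. v - 1"]) auto
  also have "\<dots> = (\<Sum>e<b. e)" by (rule sum_mod_shift_lessThan) fact
  finally have "2 * (\<Sum>S\<in>A. (\<eta> S - 1 + y) mod b) = g * (2 * (\<Sum>e<b. e))" by simp
  also have "2 * (\<Sum>e<b. e) = b * (b - 1)"
    using \<open>b > 0\<close> double_gauss_sum[of "b - 1", where 'a = nat]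
    by (cases b) (simp_all add: lessThan_Suc_atMost atMost_atLeast0)
  finally show ?thesis using card_A by simp
qed

section \<open>Tiles and subtiles of a solid labeling\<close>

locale solid_Lstar21 =
  fixes b k :: nat and \<sigma> :: real and \<phi> :: "nat \<Rightarrow> plane \<Rightarrow> int" and L :: "nat \<Rightarrow> plane set set"
  assumes \<sigma>_ge_1: "\<sigma> \<ge> 1"
    and labeling: "solid_Lstar21_labeling b k \<sigma> \<phi> L"
begin

lemma solid: "solid_fold_coloring b k \<sigma> \<phi> L"
  using labeling by (simp add: solid_Lstar21_labeling_def)

lemma b_pos: "b > 0"
  using solid by (simp add: solid_fold_coloring_def fold_coloring_def)

lemma layer_partition: "r \<in> {1..b} \<Longrightarrow> partition_on UNIV (L r)"
  using solid by (simp add: solid_fold_coloring_def tiling_def)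

lemma tile_at_eqI: "\<lbrakk>r \<in> {1..b}; T \<in> L r; p \<in> T\<rbrakk> \<Longrightarrow> tile_at (L r) p = T"
  unfolding tile_at_def using partition_onD2[OF layer_partition, of r]
  by (intro the_equality) (auto dest: disjointD)

lemma tile_at_in_layer: "r \<in> {1..b} \<Longrightarrow> tile_at (L r) p \<in> L r"
  and mem_tile_at: "r \<in> {1..b} \<Longrightarrow> p \<in> tile_at (L r) p"
proof -
  assume r: "r \<in> {1..b}"
  obtain T where "T \<in> L r" "p \<in> T" using partition_onD1[OF layer_partition[OF r]] by blast
  then show "tile_at (L r) p \<in> L r" "p \<in> tile_at (L r) p" using tile_at_eqI[OF r] by auto
qed

lemma dist_tile_less_1: "\<lbrakk>r \<in> {1..b}; T \<in> L r; p \<in> T; q \<in> T\<rbrakk> \<Longrightarrow> dist p q < 1"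
  using solid by (simp add: solid_fold_coloring_def)

lemma label_cong: "\<lbrakk>r \<in> {1..b}; q \<in> tile_at (L r) p\<rbrakk> \<Longrightarrow> \<phi> r q = \<phi> r p"
  using solid tile_at_in_layer[of r p] mem_tile_at[of r p]
  unfolding solid_fold_coloring_def constant_on_def by metis

lemma tile_label_tile_at:
  assumes "r \<in> {1..b}"
  shows "tile_label (\<phi> r) (tile_at (L r) p) = \<phi> r p"
proof -
  have "\<phi> r ` tile_at (L r) p = {\<phi> r p}"
    using label_cong[OF assms] mem_tile_at[OF assms] by force
  then show ?thesis by (simp add: tile_label_def)
qed

text \<open>Every tile is \<open>tile_at\<close> of each of its points, so the conditions on tiles
  become conditions on points. The smallest label \<open>a\<close> is fixed once for all of
  them.\<close>

lemma labels:
  obtains a :: int where "a \<in> {0, 1}"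
    and "\<And>r p. r \<in> {1..b} \<Longrightarrow> a \<le> \<phi> r p \<and> \<phi> r p \<le> a + int k - 1"
    and "\<And>r s p q. \<lbrakk>r \<in> {1..b}; s \<in> {1..b}; (r, tile_at (L r) p) \<noteq> (s, tile_at (L s) q);
      \<phi> r p = \<phi> s q\<rbrakk> \<Longrightarrow> 2 * \<sigma> < dist p q"
    and "\<And>r s p q. \<lbrakk>r \<in> {1..b}; s \<in> {1..b}; \<phi> s q = \<phi> r p + 1\<rbrakk> \<Longrightarrow> \<sigma> < dist p q"
    and "\<And>r s p q. \<lbrakk>r \<in> {1..b}; s \<in> {1..b}; \<phi> r p = a; \<phi> s q = a + int k - 1\<rbrakk>
      \<Longrightarrow> \<sigma> < dist p q"
proof -
  obtain a :: int where a: "a \<in> {0, 1}"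
    and rng: "\<forall>r\<in>{1..b}. range (\<phi> r) \<subseteq> {a..a + int k - 1}"
    and far: "\<forall>r\<in>{1..b}. \<forall>s\<in>{1..b}. \<forall>T\<in>L r. \<forall>U\<in>L s.
           ((r, T) \<noteq> (s, U) \<and> tile_label (\<phi> r) T = tile_label (\<phi> s) U
              \<longrightarrow> farther_than (2 * \<sigma>) T U) \<and>
           (tile_label (\<phi> s) U = tile_label (\<phi> r) T + 1 \<longrightarrow> farther_than \<sigma> T U) \<and>
           (tile_label (\<phi> r) T = a \<and> tile_label (\<phi> s) U = a + int k - 1
              \<longrightarrow> farther_than \<sigma> T U)"
    using labeling unfolding solid_Lstar21_labeling_def by metis
  have far': "((r, tile_at (L r) p) \<noteq> (s, tile_at (L s) q) \<and> \<phi> r p = \<phi> s q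
        \<longrightarrow> 2 * \<sigma> < dist p q) \<and>
      (\<phi> s q = \<phi> r p + 1 \<longrightarrow> \<sigma> < dist p q) \<and>
      (\<phi> r p = a \<and> \<phi> s q = a + int k - 1 \<longrightarrow> \<sigma> < dist p q)"
    if "r \<in> {1..b}" "s \<in> {1..b}" for r s p q
    using far[rule_format, OF that tile_at_in_layer[OF that(1), of p]
        tile_at_in_layer[OF that(2), of q]]
      mem_tile_at[OF that(1), of p] mem_tile_at[OF that(2), of q]
    unfolding tile_label_tile_at[OF that(1)] tile_label_tile_at[OF that(2)] farther_than_def
    by blast
  show ?thesis
    by (rule that[OF a]) (use far' rng in \<open>auto simp: image_subset_iff\<close>)
qed

text \<open>Points at distance \<open>1\<close> are adjacent and so need two labels. This gives the
  gap \<open>2\<close> for vertices in one tile, whose colors differ by a nonzero multiple of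
  \<open>k\<close>.\<close>

lemma two_le_k: "k \<ge> 2"
proof -
  obtain a :: int where rng: "\<And>r p. r \<in> {1..b} \<Longrightarrow> a \<le> \<phi> r p \<and> \<phi> r p \<le> a + int k - 1"
    by (rule labels) blast
  obtain q :: plane where "norm q = 1" using vector_choose_size[of 1] by auto
  then have "range_graph_adj \<sigma> 0 q" using \<sigma>_ge_1 by (simp add: range_graph_adj_def)
  then have "\<phi> 1 0 \<noteq> \<phi> 1 q"
    using solid b_pos unfolding solid_fold_coloring_def fold_coloring_def
    by (metis atLeastAtMost_iff less_eq_Suc_le One_nat_def order_refl)
  then show ?thesis using rng[of 1 0] rng[of 1 q] b_pos by auto
qed

section \<open>Subtiles and their number in a tile\<close>

lemma mem_subtile_at: "p \<in> subtile_at b L p"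
  by (simp add: subtile_at_def mem_tile_at)

lemma subtile_at_subset: "r \<in> {1..b} \<Longrightarrow> subtile_at b L p \<subseteq> tile_at (L r) p"
  by (auto simp: subtile_at_def)

lemma subtile_at_in_subtiles: "subtile_at b L p \<in> subtiles b L"
proof -
  have "\<forall>r\<in>{1..b}. tile_at (L r) p \<in> L r" using tile_at_in_layer by blast
  then have "subtile_at b L p \<in> {\<Inter>r\<in>{1..b}. T r |T. \<forall>r\<in>{1..b}. T r \<in> L r}"
    unfolding subtile_at_def by (intro CollectI exI[of _ "\<lambda>r. tile_at (L r) p"]) simp
  then show ?thesis unfolding subtiles_def using mem_subtile_at[of p] by blast
qed

lemma subtile_at_eqI:
  assumes "S \<in> subtiles b L" "p \<in> S"
  shows "subtile_at b L p = S"
proof -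
  obtain T where "S = (\<Inter>r\<in>{1..b}. T r)" "\<forall>r\<in>{1..b}. T r \<in> L r"
    using assms(1) by (auto simp: subtiles_def)
  moreover from this have "tile_at (L r) p = T r" if "r \<in> {1..b}" for r
    using assms(2) that by (intro tile_at_eqI) auto
  ultimately show ?thesis by (simp add: subtile_at_def)
qed

lemma subtiles_in_eq_image:
  assumes "r \<in> {1..b}" "T \<in> L r"
  shows "subtiles_in b L T = subtile_at b L ` T"
proof
  show "subtile_at b L ` T \<subseteq> subtiles_in b L T"
    using subtile_at_in_subtiles subtile_at_subset[OF assms(1)] tile_at_eqI[OF assms]
    by (fastforce simp: subtiles_in_def)
  show "subtiles_in b L T \<subseteq> subtile_at b L ` T"
  proof
    fix S assume S: "S \<in> subtiles_in b L T"
    then obtain p where "p \<in> S" by (auto simp: subtiles_in_def subtiles_def)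
    with S show "S \<in> subtile_at b L ` T" using subtile_at_eqI by (force simp: subtiles_in_def)
  qed
qed

text \<open>A subtile of a tile is determined by its labels, as the tiles of one layer that meet a
  given tile have different labels.\<close>

lemma subtiles_in_finite_card_le:
  assumes r: "r \<in> {1..b}" and T: "T \<in> L r"
  shows "finite (subtiles_in b L T) \<and> card (subtiles_in b L T) \<le> k ^ b"
proof -
  obtain a :: int where rng: "\<And>r p. r \<in> {1..b} \<Longrightarrow> a \<le> \<phi> r p \<and> \<phi> r p \<le> a + int k - 1"
    and far: "\<And>r s p q. \<lbrakk>r \<in> {1..b}; s \<in> {1..b}; (r, tile_at (L r) p) \<noteq> (s, tile_at (L s) q);
      \<phi> r p = \<phi> s q\<rbrakk> \<Longrightarrow> 2 * \<sigma> < dist p q"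
    by (rule labels) blast
  define F where "F = (\<lambda>p. restrict (\<lambda>s. \<phi> s p) {1..b})"
  define P where "P = (PiE {1..b} (\<lambda>_. {a..a + int k - 1}))"
  have fin: "finite P" unfolding P_def by (intro finite_PiE) auto
  have card_P: "card P = k ^ b" unfolding P_def by (simp add: card_PiE)
  have F_P: "F ` T \<subseteq> P" unfolding F_def P_def using rng by auto
  have inj: "subtile_at b L p = subtile_at b L q" if "p \<in> T" "q \<in> T" "F p = F q" for p q
  proof -
    have "tile_at (L s) p = tile_at (L s) q" if s: "s \<in> {1..b}" for s
    proof (rule ccontr)
      assume "tile_at (L s) p \<noteq> tile_at (L s) q"
      moreover have "\<phi> s p = \<phi> s q" using \<open>F p = F q\<close> s unfolding F_def by (metis restrict_apply')
      \<comment> \<open>Equal labels in different tiles force a distance above \<open>2\<close>, yet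
        both points lie in \<open>T\<close>.\<close>
      ultimately have "2 * \<sigma> < dist p q" using far[OF s s] by auto
      with dist_tile_less_1[OF r T \<open>p \<in> T\<close> \<open>q \<in> T\<close>] \<sigma>_ge_1 show False by simp
    qed
    then show ?thesis by (simp add: subtile_at_def)
  qed
  \<comment> \<open>Since \<open>subtile_at\<close> depends on \<open>p\<close> in \<open>T\<close>
    only through the label tuple \<open>F p\<close>, it factors through \<open>F\<close>;
    \<open>h\<close> is the factor map, defined by choosing a point for each tuple.\<close>
  define h where "h = (\<lambda>x. subtile_at b L (SOME p. p \<in> T \<and> F p = x))"
  have "subtile_at b L p = h (F p)" if "p \<in> T" for p
  proof -
    have "(SOME q. q \<in> T \<and> F q = F p) \<in> T \<and> F (SOME q. q \<in> T \<and> F q = F p) = F p"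
      using that by (intro someI_ex[where P = "\<lambda>q. q \<in> T \<and> F q = F p"]) auto
    then show ?thesis unfolding h_def using inj that by metis
  qed
  then have "subtiles_in b L T \<subseteq> h ` P"
    using F_P unfolding subtiles_in_eq_image[OF r T] by auto
  then show ?thesis
    using fin card_P by (metis card_image_le card_mono finite_imageI finite_subset order_trans)
qed

text \<open>The bound \<open>k ^ b\<close> is uniform over all tiles, so the set under
  \<open>Max\<close> is finite although there may be infinitely many tiles.\<close>

lemma card_subtiles_in_le_max:
  assumes "r \<in> {1..b}" "T \<in> L r"
  shows "card (subtiles_in b L T) \<le> max_subtiles b L"
  unfolding max_subtiles_def
proof (rule Max_ge)
  have "{card (subtiles_in b L T) |r T. r \<in> {1..b} \<and> T \<in> L r} \<subseteq> {..k ^ b}"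
    using subtiles_in_finite_card_le by auto
  then show "finite {card (subtiles_in b L T) |r T. r \<in> {1..b} \<and> T \<in> L r}"
    by (rule finite_subset) simp
qed (use assms in blast)

end

section \<open>Disk graphs\<close>

lemma disk_regions_meet_iff:
  assumes "diam D \<ge> 0" "diam D' \<ge> 0"
  shows "disk_region D \<inter> disk_region D' \<noteq> {} \<longleftrightarrow>
    dist (center D) (center D') \<le> (diam D + diam D') / 2"
    (is "?L \<longleftrightarrow> ?R")
proof
  assume ?L
  then show ?R
    using disjoint_cballI[of "diam D / 2" "diam D' / 2" "center D" "center D'"]
    unfolding disk_region_def by argo
next
  assume R: ?R
  \<comment> \<open>The common point \<open>x\<close> divides the segment between the centers in the
    ratio of the diameters.\<close>
  define t where "t = diam D / (diam D + diam D')"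
  define x where "x = center D + t *\<^sub>R (center D' - center D)"
  have t: "0 \<le> t" "t \<le> 1"
    using assms by (auto simp: t_def divide_le_eq_1)
  have "dist (center D) x = t * dist (center D) (center D')"
    using t by (simp add: x_def dist_norm norm_minus_commute)
  also have "\<dots> \<le> t * ((diam D + diam D') / 2)" using R t by (intro mult_left_mono)
  also have "\<dots> = diam D / 2" using assms by (auto simp: t_def)
  finally have x_D: "x \<in> disk_region D" by (simp add: disk_region_def)
  have "center D' - x = (1 - t) *\<^sub>R (center D' - center D)"
    by (simp add: x_def algebra_simps)
  then have "dist (center D') x = (1 - t) * dist (center D) (center D')"
    using t by (simp add: dist_norm norm_minus_commute)
  also have "\<dots> \<le> (1 - t) * ((diam D + diam D') / 2)"
    using R t by (intro mult_left_mono) auto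
  also have "(1 - t) * ((diam D + diam D') / 2) = diam D' / 2"
  \<comment> \<open>If the sum vanishes, both diameters are \<open>0\<close>, since neither is
    negative, and both sides are \<open>0\<close>.\<close>
  proof (cases "diam D + diam D' = 0")
    case False
    then have "1 - t = diam D' / (diam D + diam D')" by (simp add: t_def field_simps)
    with False show ?thesis by simp
  qed (use assms in auto)
  finally have "dist (center D') x \<le> diam D' / 2" .
  then have "x \<in> disk_region D'" by (simp add: disk_region_def)
  with x_D show ?L by blast
qed

lemma clique_number_ge:
  assumes "finite V" "K \<subseteq> V" "clique K E"
  shows "card K \<le> clique_number V E"
  unfolding clique_number_def
proof (rule Max_ge)
  have "{card K |K. K \<subseteq> V \<and> clique K E} \<subseteq> card ` Pow V" by auto
  then show "finite {card K |K. K \<subseteq> V \<and> clique K E}"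
    using assms(1) by (meson finite_Pow_iff finite_imageI finite_subset)
qed (use assms in blast)

lemma graph_dist_self: "graph_dist E v v = 0"
proof -
  have "0 \<in> {m. (v, v) \<in> {(x, y). {x, y} \<in> E} ^^ m}" by simp
  then have "graph_dist E v v \<le> enat 0" unfolding graph_dist_def by (rule INF_lower)
  then show ?thesis by (simp flip: zero_enat_def)
qed

text \<open>A finite distance excludes an empty set of walk lengths, and a nonempty set of extended
  naturals attains its infimum, so a walk of length \<open>2\<close> exists.\<close>

lemma graph_dist_2E:
  assumes "graph_dist E u v = 2"
  obtains w where "{u, w} \<in> E" "{w, v} \<in> E"
proof -
  let ?M = "{m. (u, v) \<in> {(x, y). {x, y} \<in> E} ^^ m}"
  have "enat ` ?M \<noteq> {}"
  proof
    assume "enat ` ?M = {}"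
    then have "graph_dist E u v = Inf {}" by (simp only: graph_dist_def)
    with assms show False by (simp add: top_enat_def numeral_eq_enat)
  qed
  then have "Inf (enat ` ?M) \<in> enat ` ?M"
    unfolding Inf_enat_def by (auto intro: LeastI)
  then have "enat 2 \<in> enat ` ?M" using assms unfolding graph_dist_def by (simp add: numeral_eq_enat)
  then have "(u, v) \<in> {(x, y). {x, y} \<in> E} ^^ 2" by auto
  then show ?thesis using that by (auto simp: numeral_2_eq_2)
qed

section \<open>The algorithm\<close>

locale fold_shade_color = solid_Lstar21 +
  fixes \<eta> :: "plane set \<Rightarrow> nat" and D :: "nat \<Rightarrow> disk" and n :: nat
  assumes shading: "shading b L \<eta>"
    and diam: "\<And>i. i \<in> {1..n} \<Longrightarrow> 1 \<le> diam (D i) \<and> diam (D i) \<le> \<sigma>"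
begin

abbreviation layer :: "nat \<Rightarrow> nat" where "layer \<equiv> fsc_layer b L \<eta> D"
abbreviation rank :: "nat \<Rightarrow> nat" where "rank \<equiv> fsc_rank b L \<eta> D"
abbreviation pos :: "nat \<Rightarrow> plane" where "pos i \<equiv> center (D i)"
abbreviation tile :: "nat \<Rightarrow> plane set" where "tile i \<equiv> tile_at (L (layer i)) (pos i)"

lemma layer_mem: "layer i \<in> {1..b}"
  using b_pos by (auto simp: fsc_layer_def Let_def Suc_le_eq)

lemma edge_iff:
  "{i, j} \<in> disk_graph_edges n D \<longleftrightarrow> i \<in> {1..n} \<and> j \<in> {1..n} \<and> i \<noteq> j \<and>
    dist (pos i) (pos j) \<le> (diam (D i) + diam (D j)) / 2"
proof -
  have "{i, j} \<in> disk_graph_edges n D \<longleftrightarrow> i \<in> {1..n} \<and> j \<in> {1..n} \<and> i \<noteq> j \<and>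
      disk_region (D i) \<inter> disk_region (D j) \<noteq> {}"
    unfolding disk_graph_edges_def by (auto simp: doubleton_eq_iff)
  also have "\<dots> \<longleftrightarrow> i \<in> {1..n} \<and> j \<in> {1..n} \<and> i \<noteq> j \<and>
      dist (pos i) (pos j) \<le> (diam (D i) + diam (D j)) / 2"
    using disk_regions_meet_iff[of "D i" "D j"] diam[of i] diam[of j] by force
  finally show ?thesis .
qed

section \<open>The conditions of an \<open>L(2,1)\<close>-labeling\<close>

lemma edge_dist_le: "{i, j} \<in> disk_graph_edges n D \<Longrightarrow> dist (pos i) (pos j) \<le> \<sigma>"
  using edge_iff[of i j] diam[of i] diam[of j] by auto

text \<open>Everything counted for \<open>i\<close> is also counted for \<open>j\<close>, and
  \<open>i\<close> itself is counted only for \<open>j\<close>.\<close>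

lemma rank_less:
  assumes "1 \<le> i" "i < j" "layer i = layer j" "tile i = tile j"
  shows "rank i < rank j"
  unfolding fsc_rank_def Let_def assms(3) using assms(1,2,4) mem_tile_at[OF layer_mem, of "pos i" i]
  by (intro psubset_card_mono) (auto simp: assms(3))

lemma rank_neq:
  assumes "i \<in> {1..n}" "j \<in> {1..n}" "i \<noteq> j" "layer i = layer j" "tile i = tile j"
  shows "rank i \<noteq> rank j"
  using rank_less[of i j] rank_less[of j i] assms by (cases i j rule: linorder_cases) auto

text \<open>The color difference is \<open>x + k * y\<close> with \<open>x\<close> a difference of
  labels and \<open>y\<close> one of ranks. Different tiles give
  \<open>2 \<le> \<bar>x\<bar> \<le> k - 2\<close>, which keeps \<open>x\<close> at least
  \<open>2\<close> away from every multiple of \<open>k\<close>; a common tile and layer give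
  \<open>x = 0\<close> and \<open>y \<noteq> 0\<close>.\<close>

lemma color_adjacent:
  assumes e: "{i, j} \<in> disk_graph_edges n D"
  shows "\<bar>FoldShadeColor b k \<phi> L \<eta> D i - FoldShadeColor b k \<phi> L \<eta> D j\<bar> \<ge> 2"
proof -
  obtain a :: int where rng: "\<And>r p. r \<in> {1..b} \<Longrightarrow> a \<le> \<phi> r p \<and> \<phi> r p \<le> a + int k - 1"
    and same: "\<And>r s p q. \<lbrakk>r \<in> {1..b}; s \<in> {1..b}; (r, tile_at (L r) p) \<noteq> (s, tile_at (L s) q);
      \<phi> r p = \<phi> s q\<rbrakk> \<Longrightarrow> 2 * \<sigma> < dist p q"
    and consec: "\<And>r s p q. \<lbrakk>r \<in> {1..b}; s \<in> {1..b}; \<phi> s q = \<phi> r p + 1\<rbrakk> \<Longrightarrow> \<sigma> < dist p q"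
    and ends: "\<And>r s p q. \<lbrakk>r \<in> {1..b}; s \<in> {1..b}; \<phi> r p = a; \<phi> s q = a + int k - 1\<rbrakk>
      \<Longrightarrow> \<sigma> < dist p q"
    by (rule labels) blast
  have ij: "i \<in> {1..n}" "j \<in> {1..n}" "i \<noteq> j" using e edge_iff by auto
  have close: "dist (pos i) (pos j) \<le> \<sigma>" using e by (rule edge_dist_le)
  define x where "x = \<phi> (layer i) (pos i) - \<phi> (layer j) (pos j)"
  define y where "y = int (rank i) - int (rank j)"
  have c: "FoldShadeColor b k \<phi> L \<eta> D i - FoldShadeColor b k \<phi> L \<eta> D j = x + int k * y"
    by (simp add: FoldShadeColor_def x_def y_def algebra_simps)
  have ky: "int k \<le> \<bar>int k * y\<bar>" if "y \<noteq> 0"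
    using that mult_left_mono[of 1 "\<bar>y\<bar>" "int k"] by (simp add: abs_mult)
  show ?thesis
  \<comment> \<open>The layer is part of the comparison because one set may be a tile of several
    layers.\<close>
  proof (cases "(layer i, tile i) = (layer j, tile j)")
    case True
    then have lay: "layer i = layer j" and til: "tile i = tile j" by blast+
    have "pos i \<in> tile j" unfolding til[symmetric] by (rule mem_tile_at[OF layer_mem])
    then have "x = 0" unfolding x_def lay using label_cong[OF layer_mem] by simp
    moreover have "y \<noteq> 0" using rank_neq[OF ij lay til] by (simp add: y_def)
    ultimately show ?thesis using c ky two_le_k by simp
  next
    case False
    note rng' = rng[OF layer_mem, of i "pos i"] rng[OF layer_mem, of j "pos j"]
    have "x \<noteq> 0"
      using same[OF layer_mem layer_mem False] close \<sigma>_ge_1 by (auto simp: x_def)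
    moreover have "x \<noteq> 1" "x \<noteq> -1"
      using consec[OF layer_mem layer_mem, of j "pos j" i "pos i"]
        consec[OF layer_mem layer_mem, of i "pos i" j "pos j"] close
      by (auto simp: x_def dist_commute)
    moreover have "x \<noteq> int k - 1" "x \<noteq> - (int k - 1)"
      using ends[OF layer_mem layer_mem, of j "pos j" i "pos i"]
        ends[OF layer_mem layer_mem, of i "pos i" j "pos j"] close rng'
      by (auto simp: x_def dist_commute)
    moreover have "\<bar>x\<bar> \<le> int k - 1" using rng' by (auto simp: x_def)
    ultimately have "2 \<le> \<bar>x\<bar>" "\<bar>x\<bar> \<le> int k - 2" by auto
    then show ?thesis using c ky by (cases "y = 0") auto
  qed
qed

text \<open>Equal colors make \<open>x\<close> a multiple of \<open>k\<close> smaller than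
  \<open>k\<close> in absolute value, so labels and ranks agree. Two edges span at most
  \<open>2 * \<sigma>\<close>, so tile and layer agree too, where ranks are distinct.\<close>

lemma color_distance_2:
  assumes ij: "i \<in> {1..n}" "j \<in> {1..n}" and d: "graph_dist (disk_graph_edges n D) i j = 2"
  shows "FoldShadeColor b k \<phi> L \<eta> D i \<noteq> FoldShadeColor b k \<phi> L \<eta> D j"
proof
  assume eq: "FoldShadeColor b k \<phi> L \<eta> D i = FoldShadeColor b k \<phi> L \<eta> D j"
  obtain a :: int where rng: "\<And>r p. r \<in> {1..b} \<Longrightarrow> a \<le> \<phi> r p \<and> \<phi> r p \<le> a + int k - 1"
    and same: "\<And>r s p q. \<lbrakk>r \<in> {1..b}; s \<in> {1..b}; (r, tile_at (L r) p) \<noteq> (s, tile_at (L s) q);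
      \<phi> r p = \<phi> s q\<rbrakk> \<Longrightarrow> 2 * \<sigma> < dist p q"
    by (rule labels) blast
  have "i \<noteq> j" using d by (auto simp: graph_dist_self)
  obtain w where "{i, w} \<in> disk_graph_edges n D" "{w, j} \<in> disk_graph_edges n D"
    using d by (rule graph_dist_2E)
  then have close: "dist (pos i) (pos j) \<le> 2 * \<sigma>"
    using edge_dist_le[of i w] edge_dist_le[of w j] dist_triangle[of "pos i" "pos j" "pos w"]
    by linarith
  define x where "x = \<phi> (layer i) (pos i) - \<phi> (layer j) (pos j)"
  define y where "y = int (rank j) - int (rank i)"
  have x: "x = int k * y" using eq by (simp add: FoldShadeColor_def x_def y_def algebra_simps)
  have "\<bar>x\<bar> < int k"
    using rng[OF layer_mem, of i "pos i"] rng[OF layer_mem, of j "pos j"] by (auto simp: x_def)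
  then have "y = 0" using x 
    using mult_left_mono[of 1 "\<bar>y\<bar>" "int k"] by (fastforce simp: abs_mult)
  then have "\<phi> (layer i) (pos i) = \<phi> (layer j) (pos j)" "rank i = rank j"
    using x by (auto simp: x_def y_def)
  then show False
    using same[OF layer_mem layer_mem, of i "pos i" j "pos j"] close rank_neq[OF ij \<open>i \<noteq> j\<close>]
    by fastforce
qed

section \<open>The bound on the largest label\<close>

lemma clique_in_tile:
  assumes "r \<in> {1..b}" "T \<in> L r"
  shows "clique {j \<in> {1..n}. pos j \<in> T} (disk_graph_edges n D)"
  unfolding clique_def
proof (intro ballI impI)
  fix i j assume ij: "i \<in> {j \<in> {1..n}. pos j \<in> T}" "j \<in> {j \<in> {1..n}. pos j \<in> T}" "i \<noteq> j"
  then have "dist (pos i) (pos j) < 1" using dist_tile_less_1[OF assms] by auto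
  \<comment> \<open>All diameters are at least \<open>1\<close>, so disks whose centers are less
    than \<open>1\<close> apart meet.\<close>
  with ij show "{i, j} \<in> disk_graph_edges n D"
    using diam[of i] diam[of j] by (auto simp: edge_iff)
qed

lemma card_subtile_layer_le:
  assumes "S \<in> subtiles b L" "l \<in> {1..b}"
  shows "b * card {j \<in> {1..n}. pos j \<in> S \<and> layer j = l}
    \<le> card {j \<in> {1..n}. pos j \<in> S} + (\<eta> S - 1 + (b - l)) mod b"
proof -
  let ?J = "{j \<in> {1..n}. pos j \<in> S}"
  have "layer j = 1 + (\<eta> S - 1 + card {i \<in> ?J. i < j}) mod b" if "j \<in> ?J" for j
  proof -
    have "{i \<in> {1..<j}. pos i \<in> S} = {i \<in> ?J. i < j}" using that by auto
    then show ?thesis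
      using that subtile_at_eqI[OF assms(1), of "pos j"] by (simp add: fsc_layer_def)
  qed
  \<comment> \<open>Layers start at \<open>1\<close> and residues at \<open>0\<close>: layer
    \<open>l\<close> is residue \<open>l - 1\<close>, and the offset \<open>b - 1 - (l - 1)\<close>
    becomes \<open>b - l\<close>.\<close>
  then have "{j \<in> {1..n}. pos j \<in> S \<and> layer j = l} =
      {j \<in> ?J. (\<eta> S - 1 + card {i \<in> ?J. i < j}) mod b = l - 1}"
    using assms(2) by auto
  then show ?thesis
    using card_cyclic_assignment_le[of ?J "l - 1" b "\<eta> S - 1"] assms(2) by auto
qed

text \<open>The estimate for one subtile is summed over the subtiles of \<open>T\<close>: the vertex
  counts add up to a clique, and the offsets are evaluated by the balance of the shading.\<close>

lemma card_tile_layer_le: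
  assumes l: "l \<in> {1..b}" and T: "T \<in> L l"
  shows "2 * (b * card {j \<in> {1..n}. pos j \<in> T \<and> layer j = l})
    \<le> 2 * clique_number {1..n} (disk_graph_edges n D) + (b - 1) * max_subtiles b L"
proof -
  let ?A = "subtiles_in b L T"
  have fin: "finite ?A" using subtiles_in_finite_card_le[OF l T] by simp
  \<comment> \<open>The predicate \<open>Q\<close> is kept general because the split is used both
    for one layer and for all vertices of \<open>T\<close>.\<close>
  have card_split: "card {j \<in> {1..n}. pos j \<in> T \<and> Q j} =
      (\<Sum>S\<in>?A. card {j \<in> {1..n}. pos j \<in> S \<and> Q j})" for Q
  proof -
    have "{j \<in> {1..n}. pos j \<in> T \<and> Q j} = (\<Union>S\<in>?A. {j \<in> {1..n}. pos j \<in> S \<and> Q j})"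
    proof -
      have "\<Union>?A = T"
        using mem_subtile_at subtiles_in_eq_image[OF l T] by (fastforce simp: subtiles_in_def)
      then show ?thesis by blast
    qed
    also have "card \<dots> = (\<Sum>S\<in>?A. card {j \<in> {1..n}. pos j \<in> S \<and> Q j})"
    proof (rule card_UN_disjoint[OF fin])
      show "\<forall>S\<in>?A. \<forall>S'\<in>?A. S \<noteq> S' \<longrightarrow>
          {j \<in> {1..n}. pos j \<in> S \<and> Q j} \<inter> {j \<in> {1..n}. pos j \<in> S' \<and> Q j} = {}"
        \<comment> \<open>A subtile is determined by any of its points, so distinct subtiles are
          disjoint.\<close>
        using subtile_at_eqI unfolding subtiles_in_def by blast
    qed auto
    finally show ?thesis .
  qed
  have "b * card {j \<in> {1..n}. pos j \<in> T \<and> layer j = l} =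
      (\<Sum>S\<in>?A. b * card {j \<in> {1..n}. pos j \<in> S \<and> layer j = l})"
    by (simp only: card_split sum_distrib_left)
  also have "\<dots> \<le> (\<Sum>S\<in>?A. card {j \<in> {1..n}. pos j \<in> S} + (\<eta> S - 1 + (b - l)) mod b)"
    using card_subtile_layer_le[OF _ l] by (intro sum_mono) (simp add: subtiles_in_def)
  also have "\<dots> = card {j \<in> {1..n}. pos j \<in> T} + (\<Sum>S\<in>?A. (\<eta> S - 1 + (b - l)) mod b)"
    using card_split[of "\<lambda>_. True"] by (simp add: sum.distrib)
  finally have "2 * (b * card {j \<in> {1..n}. pos j \<in> T \<and> layer j = l}) \<le>
      2 * card {j \<in> {1..n}. pos j \<in> T} + 2 * (\<Sum>S\<in>?A. (\<eta> S - 1 + (b - l)) mod b)"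
    by simp
  also have "2 * (\<Sum>S\<in>?A. (\<eta> S - 1 + (b - l)) mod b) = card ?A * (b - 1)"
  proof (rule sum_balanced_mod[OF fin b_pos])
    show "\<eta> ` ?A \<subseteq> {1..b}" using shading by (auto simp: shading_def subtiles_in_def)
    show "card {S \<in> ?A. \<eta> S = v} = card {S \<in> ?A. \<eta> S = w}" if "v \<in> {1..b}" "w \<in> {1..b}" for v w
      using shading l T that unfolding shading_def by blast
  qed
  also have "card ?A * (b - 1) \<le> (b - 1) * max_subtiles b L"
    using card_subtiles_in_le_max[OF l T] by (simp add: mult.commute)
  finally show ?thesis
    using clique_number_ge[OF _ _ clique_in_tile[OF l T], of "{1..n}"] by fastforce
qed

lemma color_le:
  assumes i: "i \<in> {1..n}"
  shows "FoldShadeColor b k \<phi> L \<eta> D i \<le> int k *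
    \<lfloor>(real (clique_number {1..n} (disk_graph_edges n D)) +
       (real b - 1) * real (max_subtiles b L) / 2) / real b\<rfloor>"
proof -
  obtain a :: int where a: "a \<in> {0, 1}"
    and rng: "\<And>r p. r \<in> {1..b} \<Longrightarrow> a \<le> \<phi> r p \<and> \<phi> r p \<le> a + int k - 1"
    by (rule labels) blast
  let ?\<omega> = "clique_number {1..n} (disk_graph_edges n D)" and ?\<gamma> = "max_subtiles b L"
  let ?B = "{j \<in> {1..n}. pos j \<in> tile i \<and> layer j = layer i}"
  \<comment> \<open>The inequality is strict because \<open>i\<close> belongs to \<open>?B\<close>
    but is not counted by its own rank.\<close>
  have "rank i < card ?B"
    unfolding fsc_rank_def Let_def using i mem_tile_at[OF layer_mem, of "pos i" i]
    by (intro psubset_card_mono) auto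
  then have "2 * (b * (rank i + 1)) \<le> 2 * (b * card ?B)" by (intro mult_le_mono2) simp
  also have "\<dots> \<le> 2 * ?\<omega> + (b - 1) * ?\<gamma>"
    by (rule card_tile_layer_le[OF layer_mem tile_at_in_layer[OF layer_mem]])
  finally have "real (2 * (b * (rank i + 1))) \<le> real (2 * ?\<omega> + (b - 1) * ?\<gamma>)"
    by (simp only: of_nat_le_iff)
  then have "2 * (real b * (real (rank i) + 1)) \<le> 2 * real ?\<omega> + (real b - 1) * real ?\<gamma>"
    using b_pos by (simp add: of_nat_diff Suc_leI distrib_left)
  then have "real b * (real (rank i) + 1) \<le> real ?\<omega> + (real b - 1) * real ?\<gamma> / 2"
    by simp
  then have "real (rank i) + 1 \<le> (real ?\<omega> + (real b - 1) * real ?\<gamma> / 2) / real b"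
    using b_pos by (simp add: pos_le_divide_eq mult.commute)
  \<comment> \<open>The left side is an integer, so the floor comes at no cost.\<close>
  then have "int (rank i) + 1 \<le> \<lfloor>(real ?\<omega> + (real b - 1) * real ?\<gamma> / 2) / real b\<rfloor>"
    by (simp add: le_floor_iff)
  then have "int k * (int (rank i) + 1) \<le>
      int k * \<lfloor>(real ?\<omega> + (real b - 1) * real ?\<gamma> / 2) / real b\<rfloor>"
    by (intro mult_left_mono) auto
  \<comment> \<open>As \<open>a \<le> 1\<close>, every label is at most \<open>k\<close>.\<close>
  moreover have "FoldShadeColor b k \<phi> L \<eta> D i \<le> int k * (int (rank i) + 1)"
    using rng[OF layer_mem, of i "pos i"] a by (auto simp: FoldShadeColor_def algebra_simps)
  ultimately show ?thesis by (rule order_trans[rotated])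
qed

end

theorem mainTheorem15:
  fixes \<sigma> :: real and b k n :: nat
    and \<phi> :: "nat \<Rightarrow> plane \<Rightarrow> int" and L :: "nat \<Rightarrow> plane set set"
    and \<eta> :: "plane set \<Rightarrow> nat" and D :: "nat \<Rightarrow> disk"
  defines "V \<equiv> {1..n}"
    and "E \<equiv> disk_graph_edges n D"
    and "c \<equiv> FoldShadeColor b k \<phi> L \<eta> D"
    and "\<gamma> \<equiv> max_subtiles b L"
  assumes "\<sigma> \<ge> 1"
    and "solid_Lstar21_labeling b k \<sigma> \<phi> L"
    and "shading b L \<eta>"
    and "\<forall>i\<in>{1..n}. diam (D i) \<in> {1..\<sigma>}"
  shows "L21_labeling V E c \<and>
    (\<forall>i\<in>V. c i \<le> int k * \<lfloor>(real (clique_number V E) + (real b - 1) * real \<gamma> / 2) / real b\<rfloor>)"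
proof -
  interpret fold_shade_color b k \<sigma> \<phi> L \<eta> D n
    using assms by unfold_locales auto
  show ?thesis
    unfolding L21_labeling_def V_def E_def c_def \<gamma>_def
    using color_adjacent color_distance_2 color_le by blast
qed

end
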